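(* Let $M$ be a sparse paving matroid of rank $2\le k\le n-2$ on a ground set $E$ with $n=|E|$, with no loops and no coloops. Then $\{d_i(M)\}_{i=1}^{n-k}$ is subadditive and cosubadditive. Moreover, for any $s=(n-k)q+r$ with $r\in[n-k]$ and $q\in\mathbb{Z}_{\ge0}$, \[ \alpha(I_{\Delta(M)}^{(s)})=nq+d_r(M)=\begin{cases} nq+k & \text{if } r=1 \text{ and } M \text{ is not uniform},\\ nq+(k+r) & \text{otherwise.}\end{cases} \] In particular, $\widehat{\alpha}(I_{\Delta(M)})=\frac{n}{n-k}$.
   Context: $[m]=\{1,\dots,m\}$. A matroid of rank $k$ is paving if every circuit has size $k$ or $k+1$; it is sparse paving if it and its dual $M^*$ are both paving. It is uniform if every $k$-subset of $E$ is a basis. For $r\in[n-k]$, $d_r(M)=\min\{|U|: U\subseteq E,\ |U|-\mathrm{rk}_M(U)=r\}$ is the $r$-th generalized Hamming weight. A sequence $\{e_i\}_{i=1}^m$ is subadditive if $e_{i+j}\le e_i+e_j$ whenever $i,j,i+j\in[m]$; the sequence $\{d_i(M)\}_{i=1}^{n-k}$ is cosubadditive if its Wei dual, i.e. the sequence listing $[n]\setminus\{n+1-d_j(M): j\in[n-k]\}$ in increasing order (equivalently $\{d_i(M^* )\}_{i=1}^k$), is subadditive. Let $S=\mathbb{L}[x_e: e\in E]$, $\mathbb{L}$ a field. $I_{\Delta(M)}=\langle\prod_{e\in C}x_e: C\text{ a circuit of }M\rangle$ is the Stanley-Reisner ideal of the independence complex of $M$, with symbolic powers $I_{\Delta(M)}^{(s)}=\bigcap_{B\in\mathcal{B}(M^*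 )}\langle x_e: e\in B\rangle^s$, where $\mathcal{B}(M^* )$ is the set of bases of $M^*$. $\alpha(I)$ is the smallest degree of a nonzero homogeneous element of $I$, and $\widehat{\alpha}(I)=\lim_{s\to\infty}\alpha(I^{(s)})/s$. *)

theory Defs
  imports
    Complex_Main
    "HOL-Library.Poly_Mapping"
    "HOL-Algebra.Ideal_Product"
begin

section \<open>Matroids\<close>

record 'a pre_matroid =
  ground :: "'a set"
  indep :: "'a set \<Rightarrow> bool"

locale matroid =
  fixes M :: "'a pre_matroid"
  assumes finite_ground: "finite (ground M)"
    and indep_subset_ground: "indep M X \<Longrightarrow> X \<subseteq> ground M"
    and indep_empty: "indep M {}"
    and indep_subset: "indep M X \<Longrightarrow> Y \<subseteq> X \<Longrightarrow> indep M Y"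
    and augmentation:
      "indep M X \<Longrightarrow> indep M Y \<Longrightarrow> card X < card Y \<Longrightarrow> \<exists>y \<in> Y - X. indep M (insert y X)"

definition basis :: "'a pre_matroid \<Rightarrow> 'a set \<Rightarrow> bool" where
  "basis M B \<longleftrightarrow> indep M B \<and> (\<forall>X. indep M X \<and> B \<subseteq> X \<longrightarrow> X = B)"

definition circuit :: "'a pre_matroid \<Rightarrow> 'a set \<Rightarrow> bool" where
  "circuit M C \<longleftrightarrow> C \<subseteq> ground M \<and> \<not> indep M C \<and> (\<forall>X. X \<subset> C \<longrightarrow> indep M X)"

definition rk :: "'a pre_matroid \<Rightarrow> 'a set \<Rightarrow> nat" where
  "rk M U = Max (card ` {X. X \<subseteq> U \<and> indep M X})"

text \<open>The bases of the dual are exactly the complements of the bases of the matroid; its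
  independent sets are therefore the sets that avoid some basis.\<close>

definition dual :: "'a pre_matroid \<Rightarrow> 'a pre_matroid" where
  "dual M = \<lparr>ground = ground M, indep = (\<lambda>X. X \<subseteq> ground M \<and> (\<exists>B. basis M B \<and> B \<inter> X = {}))\<rparr>"

definition loop :: "'a pre_matroid \<Rightarrow> 'a \<Rightarrow> bool" where
  "loop M e \<longleftrightarrow> circuit M {e}"

definition coloop :: "'a pre_matroid \<Rightarrow> 'a \<Rightarrow> bool" where
  "coloop M e \<longleftrightarrow> loop (dual M) e"

definition paving :: "'a pre_matroid \<Rightarrow> bool" where
  "paving M \<longleftrightarrow>
    (\<forall>C. circuit M C \<longrightarrow> card C = rk M (ground M) \<or> card C = rk M (ground M) + 1)"

definition sparse_paving :: "'a pre_matroid \<Rightarrow> bool" where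
  "sparse_paving M \<longleftrightarrow> paving M \<and> paving (dual M)"

definition uniform :: "'a pre_matroid \<Rightarrow> bool" where
  "uniform M \<longleftrightarrow> (\<forall>B. B \<subseteq> ground M \<and> card B = rk M (ground M) \<longrightarrow> basis M B)"

definition gen_hamming_weight :: "'a pre_matroid \<Rightarrow> nat \<Rightarrow> nat" where
  "gen_hamming_weight M r = Min {card U | U. U \<subseteq> ground M \<and> card U = rk M U + r}"


section \<open>Subadditive and cosubadditive sequences\<close>

text \<open>A sequence \<open>e\<^sub>1, \<dots>, e\<^sub>m\<close> is represented by a function on the naturals, of which only the
  values at \<open>1, \<dots>, m\<close> are relevant.\<close>

definition subadditive :: "nat \<Rightarrow> (nat \<Rightarrow> nat) \<Rightarrow> bool" where
  "subadditive m e \<longleftrightarrow>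
    (\<forall>i j. i \<in> {1..m} \<and> j \<in> {1..m} \<and> i + j \<in> {1..m} \<longrightarrow> e (i + j) \<le> e i + e j)"

definition wei_dual :: "nat \<Rightarrow> nat \<Rightarrow> (nat \<Rightarrow> nat) \<Rightarrow> nat list" where
  "wei_dual n m d = sorted_list_of_set ({1..n} - {n + 1 - d j | j. j \<in> {1..m}})"

text \<open>Lists are indexed from 0, hence the shift by one.\<close>

definition cosubadditive :: "nat \<Rightarrow> nat \<Rightarrow> (nat \<Rightarrow> nat) \<Rightarrow> bool" where
  "cosubadditive n m d \<longleftrightarrow>
    subadditive (length (wei_dual n m d)) (\<lambda>i. wei_dual n m d ! (i - 1))"


section \<open>Polynomials and symbolic powers\<close>

text \<open>A monomial is a finitely supported exponent vector, a polynomial a finitely supported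
  function from monomials to coefficients.\<close>

type_synonym ('a, 'l) mpoly = "('a \<Rightarrow>\<^sub>0 nat) \<Rightarrow>\<^sub>0 'l"

definition poly_ring :: "'a set \<Rightarrow> ('a, 'l::field) mpoly ring" where
  "poly_ring E = \<lparr>carrier = {p. \<forall>m \<in> Poly_Mapping.keys p. Poly_Mapping.keys m \<subseteq> E},
     monoid.mult = (*), one = 1, zero = 0, add = (+)\<rparr>"

definition var :: "'a \<Rightarrow> ('a, 'l::field) mpoly" where
  "var e = Poly_Mapping.single (Poly_Mapping.single e 1) 1"

definition monom_deg :: "('a \<Rightarrow>\<^sub>0 nat) \<Rightarrow> nat" where
  "monom_deg m = (\<Sum>e \<in> Poly_Mapping.keys m. Poly_Mapping.lookup m e)"

definition homogeneous :: "nat \<Rightarrow> ('a, 'l::field) mpoly \<Rightarrow> bool" where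
  "homogeneous d p \<longleftrightarrow> (\<forall>m \<in> Poly_Mapping.keys p. monom_deg m = d)"

definition alpha :: "('a, 'l::field) mpoly set \<Rightarrow> nat" where
  "alpha I = (LEAST d. \<exists>p \<in> I. p \<noteq> 0 \<and> homogeneous d p)"

definition SR_ideal :: "'a pre_matroid \<Rightarrow> ('a, 'l::field) mpoly set" where
  "SR_ideal M = Idl\<^bsub>poly_ring (ground M)\<^esub> {\<Prod>e \<in> C. var e | C. circuit M C}"

definition var_ideal :: "'a set \<Rightarrow> 'a set \<Rightarrow> ('a, 'l::field) mpoly set" where
  "var_ideal E B = Idl\<^bsub>poly_ring E\<^esub> (var ` B)"

text \<open>The \<open>s\<close>-th symbolic power of \<^term>\<open>SR_ideal M\<close>. Powers of ideals are powers in the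
  multiplicative monoid of ideals. Lemma \<open>SR_symbolic_power_1\<close> below shows that the first
  symbolic power is the Stanley-Reisner ideal itself.\<close>

definition SR_symbolic_power :: "'a pre_matroid \<Rightarrow> nat \<Rightarrow> ('a, 'l::field) mpoly set" where
  "SR_symbolic_power M s =
    (\<Inter>B \<in> {B. basis (dual M) B}.
       var_ideal (ground M) B [^]\<^bsub>ideals_set (poly_ring (ground M))\<^esub> s)"

text \<open>The argument is the sequence of symbolic powers of an ideal. Since \<^const>\<open>lim\<close> is a
  total function, existence of the limit has to be asserted separately.\<close>

definition waldschmidt :: "(nat \<Rightarrow> ('a, 'l::field) mpoly set) \<Rightarrow> real" where
  "waldschmidt I = lim (\<lambda>s. real (alpha (I s)) / real s)"


section \<open>Basic facts\<close>

context matroid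
begin

lemma indep_finite: "indep M X \<Longrightarrow> finite X"
  using indep_subset_ground finite_ground finite_subset by blast

lemma extend_within:
  assumes X: "indep M X" and XU: "X \<subseteq> U"
  shows "\<exists>Y. X \<subseteq> Y \<and> Y \<subseteq> U \<and> indep M Y \<and> (\<forall>Z. indep M Z \<and> Z \<subseteq> U \<longrightarrow> card Z \<le> card Y)"
proof -
  let ?S = "{Y. X \<subseteq> Y \<and> Y \<subseteq> U \<and> indep M Y}"
  have "?S \<subseteq> Pow (ground M)" using indep_subset_ground by auto
  then have fin: "finite ?S" using finite_ground finite_subset by blast
  have ne: "?S \<noteq> {}" using assms by auto
  obtain Y where Y: "Y \<in> ?S" and mx: "\<And>Z. Z \<in> ?S \<Longrightarrow> card Z \<le> card Y"
  proof -
    have "Max (card ` ?S) \<in> card ` ?S" by (rule Max_in) (use fin ne in auto)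
    then obtain Y where Y: "Y \<in> ?S" "Max (card ` ?S) = card Y" by (rule imageE)
    have "card Z \<le> card Y" if "Z \<in> ?S" for Z
      unfolding Y(2)[symmetric] by (rule Max_ge[OF finite_imageI[OF fin] imageI[OF that]])
    with Y(1) show ?thesis by (rule that)
  qed
  have "card Z \<le> card Y" if Z: "indep M Z" "Z \<subseteq> U" for Z
  proof (rule ccontr)
    assume "\<not> card Z \<le> card Y"
    then obtain y where y: "y \<in> Z - Y" "indep M (insert y Y)"
      using augmentation[of Y Z] Y Z by auto
    then have "insert y Y \<in> ?S" using Y Z by auto
    from mx[OF this] have "card (insert y Y) \<le> card Y" .
    moreover have "finite Y" using Y indep_finite by auto
    ultimately show False using y by (simp add: card_insert_if)
  qed
  then show ?thesis using Y by blast
qed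

lemma basis_card_le:
  assumes "basis M B" "indep M X"
  shows "card X \<le> card B"
proof (rule ccontr)
  assume "\<not> card X \<le> card B"
  then obtain y where y: "y \<in> X - B" "indep M (insert y B)"
    using augmentation[of B X] assms by (auto simp: basis_def)
  then show False using assms(1) unfolding basis_def by blast
qed

lemma basisI_card:
  assumes "indep M B" "\<And>X. indep M X \<Longrightarrow> card X \<le> card B"
  shows "basis M B"
  unfolding basis_def using assms indep_finite card_seteq by metis

lemma indep_extend_basis:
  assumes "indep M X"
  shows "\<exists>B. basis M B \<and> X \<subseteq> B"
  using extend_within[OF assms, of "ground M"] assms indep_subset_ground
  by (metis basisI_card)

lemma matroid_dual: "matroid (dual M)"
proof
  show "finite (ground (dual M))" by (simp add: dual_def finite_ground)
  show "indep (dual M) X \<Longrightarrow> X \<subseteq> ground (dual M)" for X by (simp add: dual_def)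
  show "indep (dual M) {}" using indep_extend_basis[OF indep_empty] by (auto simp: dual_def)
  show "indep (dual M) X \<Longrightarrow> Y \<subseteq> X \<Longrightarrow> indep (dual M) Y" for X Y
    by (auto simp: dual_def)
  fix X Y assume X: "indep (dual M) X" and Y: "indep (dual M) Y" and lt: "card X < card Y"
  obtain B where B: "basis M B" "B \<inter> X = {}" using X by (auto simp: dual_def)
  obtain B' where B': "basis M B'" "B' \<inter> Y = {}" using Y by (auto simp: dual_def)
  have sub: "X \<subseteq> ground M" "Y \<subseteq> ground M" using X Y by (auto simp: dual_def)
  then have fin: "finite X" "finite Y" using finite_ground finite_subset by auto
  have iB: "indep M B" "indep M B'" using B B' by (auto simp: basis_def)
  have "indep M (B' - X)" using indep_subset[OF iB(2), of "B' - X"] by auto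
  from extend_within[OF this, of "ground M - X"] obtain B1
    where B1: "B' - X \<subseteq> B1" "B1 \<subseteq> ground M - X" "indep M B1"
      "\<And>Z. indep M Z \<Longrightarrow> Z \<subseteq> ground M - X \<Longrightarrow> card Z \<le> card B1"
    using indep_subset_ground[OF iB(2)] by blast
  have "card B \<le> card B1" using B1(4)[OF iB(1)] indep_subset_ground[OF iB(1)] B(2) by blast
  then have bB1: "basis M B1"
    using basisI_card[OF B1(3)] basis_card_le[OF B(1)] le_trans by blast
  have "\<not> Y - X \<subseteq> B1"
  proof
    assume "Y - X \<subseteq> B1"
    then have "(Y - X) \<union> (B' - X) \<subseteq> B1" using B1(1) by auto
    then have "card ((Y - X) \<union> (B' - X)) \<le> card B1"
      using card_mono indep_finite[OF B1(3)] by blast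
    moreover have "card ((Y - X) \<union> (B' - X)) = card (Y - X) + card (B' - X)"
      using B'(2) fin indep_finite[OF iB(2)] by (intro card_Un_disjoint) auto
    moreover have "card B' = card (B' - X) + card (B' \<inter> X)"
      by (metis add.commute card_Diff_subset_Int card_mono finite_Int indep_finite[OF iB(2)]
          inf_le1 le_add_diff_inverse)
    moreover have "card (B' \<inter> X) \<le> card (X - Y)"
      using B'(2) fin by (intro card_mono) auto
    moreover have "card (X - Y) < card (Y - X)"
      using lt fin by (metis card_less_sym_Diff)
    moreover have "card B1 \<le> card B'" using basis_card_le[OF B'(1) B1(3)] .
    ultimately show False by linarith
  qed
  then obtain y where y: "y \<in> Y - X" "y \<notin> B1" by auto
  then have "indep (dual M) (insert y X)"
    using bB1 B1(2) sub by (auto simp: dual_def)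
  then show "\<exists>y\<in>Y - X. indep (dual M) (insert y X)" using y by auto
qed

lemma basis_dual_iff: "basis (dual M) B \<longleftrightarrow> B \<subseteq> ground M \<and> basis M (ground M - B)"
proof
  assume B: "basis (dual M) B"
  then obtain A where A: "B \<subseteq> ground M" "basis M A" "A \<inter> B = {}"
    by (auto simp: basis_def dual_def)
  have "indep (dual M) (ground M - A)" using A by (auto simp: dual_def)
  moreover have AE: "A \<subseteq> ground M" using A indep_subset_ground by (auto simp: basis_def)
  ultimately have "ground M - A = B" using B A unfolding basis_def by blast
  then show "B \<subseteq> ground M \<and> basis M (ground M - B)"
    using A AE by (metis double_diff order_refl)
next
  assume B: "B \<subseteq> ground M \<and> basis M (ground M - B)"
  show "basis (dual M) B"
    unfolding basis_def
  proof safe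
    show "indep (dual M) B" using B by (auto simp: dual_def)
  next
    fix X x assume X: "indep (dual M) X" "B \<subseteq> X" "x \<in> X"
    then obtain A where A: "X \<subseteq> ground M" "basis M A" "A \<inter> X = {}" by (auto simp: dual_def)
    have "A \<subseteq> ground M - B" using A X indep_subset_ground[of A] by (auto simp: basis_def)
    then have "ground M - B = A" using A(2) B unfolding basis_def by blast
    then show "x \<in> B" using X A by auto
  qed
qed

lemma dependent_contains_circuit:
  assumes "D \<subseteq> ground M" "\<not> indep M D"
  shows "\<exists>C. circuit M C \<and> C \<subseteq> D"
proof -
  have "finite D" using assms finite_ground finite_subset by auto
  then show ?thesis using assms
  proof (induction D rule: finite_psubset_induct)
    case (psubset D)
    show ?case
    proof (cases "\<forall>X. X \<subset> D \<longrightarrow> indep M X")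
      case True
      then show ?thesis using psubset.prems by (auto simp: circuit_def)
    next
      case False
      then obtain X where "X \<subset> D" "\<not> indep M X" by auto
      then show ?thesis using psubset.IH[of X] psubset.prems by blast
    qed
  qed
qed

end

lemma cring_poly_ring: "cring (poly_ring E :: ('a, 'l::field) mpoly ring)"
proof (rule cringI)
  show "abelian_group (poly_ring E :: ('a, 'l) mpoly ring)"
  proof (rule abelian_groupI)
    fix x y :: "('a, 'l) mpoly"
    assume "x \<in> carrier (poly_ring E)" "y \<in> carrier (poly_ring E)"
    then show "x \<oplus>\<^bsub>poly_ring E\<^esub> y \<in> carrier (poly_ring E)"
      using Poly_Mapping.keys_add[of x y] by (auto simp: poly_ring_def)
  next
    fix x :: "('a, 'l) mpoly" assume "x \<in> carrier (poly_ring E)"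
    then show "\<exists>y\<in>carrier (poly_ring E). y \<oplus>\<^bsub>poly_ring E\<^esub> x = \<zero>\<^bsub>poly_ring E\<^esub>"
      by (intro bexI[of _ "- x"]) (auto simp: poly_ring_def)
  qed (auto simp: poly_ring_def algebra_simps)
next
  show "Group.comm_monoid (poly_ring E :: ('a, 'l) mpoly ring)"
  proof (rule comm_monoidI)
    fix x y :: "('a, 'l) mpoly"
    assume "x \<in> carrier (poly_ring E)" "y \<in> carrier (poly_ring E)"
    then show "x \<otimes>\<^bsub>poly_ring E\<^esub> y \<in> carrier (poly_ring E)"
      using Poly_Mapping.keys_mult[of x y]
      by (fastforce simp: poly_ring_def dest!: set_mp[OF Poly_Mapping.keys_mult]
          set_mp[OF Poly_Mapping.keys_add])
  qed (auto simp: poly_ring_def algebra_simps)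
qed (auto simp: poly_ring_def algebra_simps)

lemma monom_eq_prod_var:
  "finite A \<Longrightarrow> (\<Prod>e \<in> A. var e) =
     Poly_Mapping.single (\<Sum>e \<in> A. Poly_Mapping.single e 1) (1 :: 'l::field)"
  by (induction A rule: finite_induct) (auto simp: var_def mult_single)

lemma lookup_indicator:
  "finite A \<Longrightarrow>
     Poly_Mapping.lookup (\<Sum>e \<in> A. Poly_Mapping.single e (1::nat)) x = (if x \<in> A then 1 else 0)"
  by (induction A rule: finite_induct) (auto simp: lookup_add lookup_single when_def)

lemma sum_monomials:
  "(\<Sum>m \<in> Poly_Mapping.keys p. Poly_Mapping.single m (Poly_Mapping.lookup p m)) = p"
  by (rule poly_mapping_eqI)
    (auto simp: lookup_sum lookup_single when_def not_in_keys_iff_lookup_eq_zero)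

text \<open>Membership in an ideal generated by squarefree monomials.\<close>

lemma squarefree_monomial_ideal:
  assumes E: "finite E" and F: "\<And>A. A \<in> F \<Longrightarrow> A \<subseteq> E"
  shows "Idl\<^bsub>poly_ring E\<^esub> {\<Prod>e \<in> A. var e | A. A \<in> F} =
    {p :: ('a, 'l::field) mpoly. \<forall>m \<in> Poly_Mapping.keys p.
       Poly_Mapping.keys m \<subseteq> E \<and> (\<exists>A \<in> F. A \<subseteq> Poly_Mapping.keys m)}"
    (is "Idl\<^bsub>?R\<^esub> ?G = ?J")
proof -
  interpret R: cring "?R :: ('a, 'l) mpoly ring" by (rule cring_poly_ring)
  have finA: "finite A" if "A \<in> F" for A using F[OF that] E finite_subset by auto
  have keysA: "Poly_Mapping.keys (\<Sum>e \<in> A. Poly_Mapping.single e (1::nat)) = A" if "A \<in> F" for A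
    by (auto simp: in_keys_iff lookup_indicator[OF finA[OF that], simplified] split: if_splits)
  have keys_plus: "Poly_Mapping.keys (a + b) = Poly_Mapping.keys a \<union> Poly_Mapping.keys b"
    for a b :: "'a \<Rightarrow>\<^sub>0 nat"
    by (auto simp: in_keys_iff lookup_add)
  have G: "?G \<subseteq> carrier ?R"
    using F finA keysA by (fastforce simp: poly_ring_def monom_eq_prod_var)
  have mult_J: "x * a \<in> ?J" if a: "a \<in> ?J" and x: "x \<in> carrier ?R" for a x
  proof -
    have "Poly_Mapping.keys m \<subseteq> E \<and> (\<exists>A \<in> F. A \<subseteq> Poly_Mapping.keys m)"
      if mk: "m \<in> Poly_Mapping.keys (x * a)" for m
    proof -
      obtain u v where uv: "m = u + v" "u \<in> Poly_Mapping.keys x" "v \<in> Poly_Mapping.keys a"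
        using subsetD[OF Poly_Mapping.keys_mult mk] by blast
      have "Poly_Mapping.keys u \<subseteq> E" using x uv(2) by (auto simp: poly_ring_def)
      moreover obtain A where "Poly_Mapping.keys v \<subseteq> E" "A \<in> F" "A \<subseteq> Poly_Mapping.keys v"
        using a uv(3) by auto
      ultimately show ?thesis unfolding uv(1) keys_plus by blast
    qed
    then show ?thesis by auto
  qed
  have J: "ideal ?J ?R"
  proof (rule idealI)
    show "Ring.ring ?R" by (rule R.ring_axioms)
    have inv: "inv\<^bsub>add_monoid ?R\<^esub> x = - x" if "x \<in> carrier ?R" for x
      using R.minus_equality[of "- x" x] that by (auto simp: poly_ring_def a_inv_def)
    show "subgroup ?J (add_monoid ?R)"
    proof
      show "?J \<subseteq> carrier (add_monoid ?R)" by (auto simp: poly_ring_def)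
      show "\<one>\<^bsub>add_monoid ?R\<^esub> \<in> ?J" by (auto simp: poly_ring_def)
    next
      fix x y assume "x \<in> ?J" "y \<in> ?J"
      then show "x \<otimes>\<^bsub>add_monoid ?R\<^esub> y \<in> ?J"
        using Poly_Mapping.keys_add[of x y] by (auto simp: poly_ring_def)
    next
      fix x assume "x \<in> ?J"
      then have m: "- x \<in> ?J" and c: "x \<in> carrier ?R" by (auto simp: poly_ring_def)
      show "inv\<^bsub>add_monoid ?R\<^esub> x \<in> ?J" by (subst inv[OF c]) (rule m)
    qed
  next
    fix a x assume "a \<in> ?J" "x \<in> carrier ?R"
    from mult_J[OF this] show "x \<otimes>\<^bsub>?R\<^esub> a \<in> ?J" "a \<otimes>\<^bsub>?R\<^esub> x \<in> ?J"
      by (simp_all add: poly_ring_def mult.commute)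
  qed
  have "?G \<subseteq> ?J" using F finA keysA by (fastforce simp: monom_eq_prod_var)
  then have 1: "Idl\<^bsub>?R\<^esub> ?G \<subseteq> ?J" by (rule R.genideal_minimal[OF J])
  interpret I: ideal "Idl\<^bsub>?R\<^esub> ?G" ?R by (rule R.genideal_ideal[OF G])
  have 2: "p \<in> Idl\<^bsub>?R\<^esub> ?G" if p: "p \<in> ?J" for p
  proof -
    have term_in: "Poly_Mapping.single m c \<in> Idl\<^bsub>?R\<^esub> ?G" if m: "m \<in> Poly_Mapping.keys p" for m c
    proof -
      obtain A where A: "A \<in> F" "A \<subseteq> Poly_Mapping.keys m" using p m by auto
      let ?a = "\<Sum>e \<in> A. Poly_Mapping.single e (1::nat)"
      have eq: "m = (m - ?a) + ?a"
      proof (rule poly_mapping_eqI)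
        fix x show "Poly_Mapping.lookup m x = Poly_Mapping.lookup (m - ?a + ?a) x"
          using A(2) lookup_indicator[OF finA[OF A(1)]]
          by (auto simp: lookup_add lookup_minus in_keys_iff Suc_le_eq)
      qed
      have "Poly_Mapping.keys (m - ?a) \<subseteq> Poly_Mapping.keys m"
        by (auto simp: in_keys_iff lookup_minus)
      then have "Poly_Mapping.single (m - ?a) c \<in> carrier ?R"
        using p m by (auto simp: poly_ring_def split: if_splits)
      moreover have "(\<Prod>e \<in> A. var e) \<in> Idl\<^bsub>?R\<^esub> ?G"
        using R.genideal_self[OF G] A(1) by blast
      ultimately have "Poly_Mapping.single (m - ?a) c \<otimes>\<^bsub>?R\<^esub> (\<Prod>e \<in> A. var e) \<in> Idl\<^bsub>?R\<^esub> ?G"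
        by (rule I.I_l_closed[rotated])
      also have "Poly_Mapping.single (m - ?a) c \<otimes>\<^bsub>?R\<^esub> (\<Prod>e \<in> A. var e) = Poly_Mapping.single m c"
        by (subst (2) eq) (simp add: poly_ring_def monom_eq_prod_var finA[OF A(1)] mult_single)
      finally show ?thesis .
    qed
    have zero: "0 \<in> Idl\<^bsub>?R\<^esub> ?G" using I.zero_closed by (simp add: poly_ring_def)
    have add: "x + y \<in> Idl\<^bsub>?R\<^esub> ?G" if "x \<in> Idl\<^bsub>?R\<^esub> ?G" "y \<in> Idl\<^bsub>?R\<^esub> ?G" for x y
      using I.a_closed[OF that] by (simp add: poly_ring_def)
    have "(\<Sum>m \<in> S. Poly_Mapping.single m (Poly_Mapping.lookup p m)) \<in> Idl\<^bsub>?R\<^esub> ?G"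
      if "finite S" "S \<subseteq> Poly_Mapping.keys p" for S
      using that by (induction S rule: finite_induct) (auto simp: zero intro!: add term_in)
    from this[of "Poly_Mapping.keys p"] show ?thesis
      by (simp add: sum_monomials)
  qed
  show ?thesis using 1 by (rule equalityI) (rule subsetI, rule 2)
qed

lemma (in matroid) SR_symbolic_power_1:
  "SR_symbolic_power M 1 = (SR_ideal M :: ('a, 'l::field) mpoly set)"
proof -
  let ?R = "poly_ring (ground M) :: ('a, 'l) mpoly ring"
  interpret R: cring ?R by (rule cring_poly_ring)
  have var1: "var_ideal (ground M) B [^]\<^bsub>ideals_set ?R\<^esub> (1::nat) = var_ideal (ground M) B"
    if B: "B \<subseteq> ground M" for B
  proof -
    have "var ` B \<subseteq> carrier ?R" using B by (auto simp: poly_ring_def var_def)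
    then have "ideal (var_ideal (ground M) B) ?R"
      unfolding var_ideal_def by (rule R.genideal_ideal)
    then have I: "var_ideal (ground M) B \<in> carrier (ideals_set ?R)" by (simp add: ideals_set_def)
    interpret I: Group.comm_monoid "ideals_set ?R" by (rule R.ideals_set_is_comm_monoid)
    show ?thesis using I by simp
  qed
  have var: "var_ideal (ground M) B = {p :: ('a, 'l) mpoly. \<forall>m \<in> Poly_Mapping.keys p.
       Poly_Mapping.keys m \<subseteq> ground M \<and> B \<inter> Poly_Mapping.keys m \<noteq> {}}"
    if B: "B \<subseteq> ground M" for B
  proof -
    have "var ` B = {\<Prod>e \<in> A. var e :: ('a, 'l) mpoly | A. A \<in> (\<lambda>b. {b}) ` B}"
      by (simp add: setcompr_eq_image image_image)
    then have "var_ideal (ground M) B = Idl\<^bsub>?R\<^esub> {\<Prod>e \<in> A. var e | A. A \<in> (\<lambda>b. {b}) ` B}"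
      by (simp add: var_ideal_def)
    also have "\<dots> = {p. \<forall>m \<in> Poly_Mapping.keys p. Poly_Mapping.keys m \<subseteq> ground M \<and>
        (\<exists>A \<in> (\<lambda>b. {b}) ` B. A \<subseteq> Poly_Mapping.keys m)}"
      using B by (intro squarefree_monomial_ideal finite_ground) auto
    also have "\<dots> = {p :: ('a, 'l) mpoly. \<forall>m \<in> Poly_Mapping.keys p.
       Poly_Mapping.keys m \<subseteq> ground M \<and> B \<inter> Poly_Mapping.keys m \<noteq> {}}" by auto
    finally show ?thesis .
  qed
  have "SR_ideal M = Idl\<^bsub>?R\<^esub> {\<Prod>e \<in> A. var e | A. A \<in> Collect (circuit M)}"
    by (simp add: SR_ideal_def)
  also have "\<dots> = {p. \<forall>m \<in> Poly_Mapping.keys p. Poly_Mapping.keys m \<subseteq> ground M \<and>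
      (\<exists>A \<in> Collect (circuit M). A \<subseteq> Poly_Mapping.keys m)}"
    by (intro squarefree_monomial_ideal finite_ground) (auto simp: circuit_def)
  finally have SR: "SR_ideal M = {p :: ('a, 'l) mpoly. \<forall>m \<in> Poly_Mapping.keys p.
      Poly_Mapping.keys m \<subseteq> ground M \<and> (\<exists>A. circuit M A \<and> A \<subseteq> Poly_Mapping.keys m)}"
    by simp
  have "SR_symbolic_power M 1 = (\<Inter>B \<in> {B. basis (dual M) B}. var_ideal (ground M) B :: ('a, 'l) mpoly set)"
    unfolding SR_symbolic_power_def by (intro INF_cong refl var1) (auto simp: basis_dual_iff)
  also have "\<dots> = (\<Inter>B \<in> {B. basis (dual M) B}. {p :: ('a, 'l) mpoly. \<forall>m \<in> Poly_Mapping.keys p.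
       Poly_Mapping.keys m \<subseteq> ground M \<and> B \<inter> Poly_Mapping.keys m \<noteq> {}})"
    by (intro INF_cong refl var) (auto simp: basis_dual_iff)
  finally have SP: "SR_symbolic_power M 1 = \<dots>" .
  have ex: "\<exists>B. basis (dual M) B"
    using matroid.indep_extend_basis[OF matroid_dual matroid.indep_empty[OF matroid_dual]] by blast
  have key: "(\<forall>B. basis (dual M) B \<longrightarrow> B \<inter> D \<noteq> {}) \<longleftrightarrow> (\<exists>A. circuit M A \<and> A \<subseteq> D)"
    if D: "D \<subseteq> ground M" for D
  proof
    assume L: "\<forall>B. basis (dual M) B \<longrightarrow> B \<inter> D \<noteq> {}"
    have "\<not> indep M D"
    proof
      assume "indep M D"
      then obtain B where B: "basis M B" "D \<subseteq> B" using indep_extend_basis by blast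
      then have "B \<subseteq> ground M" using indep_subset_ground by (auto simp: basis_def)
      then have "basis (dual M) (ground M - B)" using B by (auto simp: basis_dual_iff double_diff)
      then show False using L B by blast
    qed
    then show "\<exists>A. circuit M A \<and> A \<subseteq> D" using dependent_contains_circuit D by blast
  next
    assume "\<exists>A. circuit M A \<and> A \<subseteq> D"
    then have nD: "\<not> indep M D" using indep_subset by (auto simp: circuit_def)
    show "\<forall>B. basis (dual M) B \<longrightarrow> B \<inter> D \<noteq> {}"
    proof (intro allI impI notI)
      fix B assume "basis (dual M) B" "B \<inter> D = {}"
      then have "indep M (ground M - B)" "D \<subseteq> ground M - B"
        using D unfolding basis_dual_iff by (auto simp: basis_def)
      then show False using nD indep_subset by blast
    qed
  qed
  have "p \<in> SR_symbolic_power M 1 \<longleftrightarrow> p \<in> SR_ideal M" for p :: "('a, 'l) mpoly"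
  proof -
    have "p \<in> SR_symbolic_power M 1 \<longleftrightarrow> (\<forall>m \<in> Poly_Mapping.keys p. Poly_Mapping.keys m \<subseteq> ground M \<and>
        (\<forall>B. basis (dual M) B \<longrightarrow> B \<inter> Poly_Mapping.keys m \<noteq> {}))"
      unfolding SP using ex by blast
    also have "\<dots> \<longleftrightarrow> p \<in> SR_ideal M" unfolding SR mem_Collect_eq by (intro ball_cong conj_cong key refl)
    finally show ?thesis .
  qed
  then show ?thesis by blast
qed

end

theory Submission
  imports Defs
begin

text \<open>A monomial lies in \<open>I\<^bsub>\<Delta>(M)\<^esub>\<^sup>(\<^sup>s\<^sup>)\<close> iff its exponent vector \<open>w\<close> has weight at least \<open>s\<close> on the
  complement of every basis of \<open>M\<close>, so \<open>\<alpha>\<close> is the minimum of the total weight under these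
  constraints. The vector \<open>q \<cdot> 1 + 1\<^sub>U\<close> with \<open>U\<close> attaining \<open>d\<^sub>r(M)\<close> gives the upper bound. For the
  lower bound, let \<open>T\<close> be a \<open>k\<close>-set of maximal weight. If its complement meets the constraint, it
  contains an element of weight at least \<open>q + 1\<close>, hence so does all of \<open>T\<close>. Otherwise \<open>T\<close> is a
  circuit-hyperplane, and exchanging the lightest element of \<open>T\<close> for the heaviest one outside
  \<open>T\<close> produces a basis, whose constraint forces \<open>T\<close> to be heavy.\<close>

section \<open>Powers of ideals generated by variables\<close>

text \<open>A polynomial is the sum of its own terms. Restricting the \<open>single\<close> case to
  terms of \<open>p\<close> keeps facts about the keys of \<open>p\<close> available there.\<close>

lemma poly_mapping_single_add_induct [case_names zero single add]:
  fixes p :: "'b \<Rightarrow>\<^sub>0 'c::comm_monoid_add"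
  assumes "P 0"
    and "\<And>m. m \<in> Poly_Mapping.keys p \<Longrightarrow> P (Poly_Mapping.single m (Poly_Mapping.lookup p m))"
    and "\<And>x y. P x \<Longrightarrow> P y \<Longrightarrow> P (x + y)"
  shows "P p"
proof -
  have "P (\<Sum>m \<in> S. Poly_Mapping.single m (Poly_Mapping.lookup p m))"
    if "finite S" "S \<subseteq> Poly_Mapping.keys p" for S
    using that by (induction S rule: finite_induct) (auto intro: assms)
  from this[OF finite_keys order_refl] show ?thesis by (simp only: sum_monomials)
qed

lemma keys_plus_nat:
  "Poly_Mapping.keys (a + b) = Poly_Mapping.keys a \<union> Poly_Mapping.keys (b :: 'a \<Rightarrow>\<^sub>0 nat)"
  by (auto simp: in_keys_iff lookup_add)

lemma var_ideal_eq:
  assumes "finite E" "B \<subseteq> E"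
  shows "var_ideal E B = {p :: ('a, 'l::field) mpoly. \<forall>m \<in> Poly_Mapping.keys p.
       Poly_Mapping.keys m \<subseteq> E \<and> B \<inter> Poly_Mapping.keys m \<noteq> {}}"
proof -
  let ?R = "poly_ring E :: ('a, 'l) mpoly ring"
  have "var ` B = {\<Prod>e \<in> A. var e :: ('a, 'l) mpoly | A. A \<in> (\<lambda>b. {b}) ` B}"
    by (simp add: setcompr_eq_image image_image)
  then have "var_ideal E B = Idl\<^bsub>?R\<^esub> {\<Prod>e \<in> A. var e | A. A \<in> (\<lambda>b. {b}) ` B}"
    by (simp add: var_ideal_def)
  also have "\<dots> = {p. \<forall>m \<in> Poly_Mapping.keys p. Poly_Mapping.keys m \<subseteq> E \<and>
      (\<exists>A \<in> (\<lambda>b. {b}) ` B. A \<subseteq> Poly_Mapping.keys m)}"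
    using assms by (intro squarefree_monomial_ideal) auto
  finally show ?thesis by auto
qed

text \<open>The sum on the right is the degree of the monomial in the variables of \<open>B\<close>.
  These degrees add up under products, and from a term of degree at least \<open>Suc s\<close> one
  variable of \<open>B\<close> can be split off.\<close>

lemma var_ideal_power_eq:
  assumes "finite E" "B \<subseteq> E"
  shows "var_ideal E B [^]\<^bsub>ideals_set (poly_ring E)\<^esub> (s::nat) =
    {p :: ('a, 'l::field) mpoly. \<forall>m \<in> Poly_Mapping.keys p.
       Poly_Mapping.keys m \<subseteq> E \<and> s \<le> (\<Sum>e \<in> B. Poly_Mapping.lookup m e)}"
proof (induction s)
  case 0
  \<comment> \<open>The zeroth power is the unit of the monoid of ideals, that is, the whole ring;
    the bound on the degree is then trivial.\<close>
  show ?case by (simp add: ideals_set_def poly_ring_def)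
next
  case (Suc s)
  let ?R = "poly_ring E :: ('a, 'l) mpoly ring"
  let ?P = "\<lambda>s. {p :: ('a, 'l) mpoly. \<forall>m \<in> Poly_Mapping.keys p.
       Poly_Mapping.keys m \<subseteq> E \<and> s \<le> (\<Sum>e \<in> B. Poly_Mapping.lookup m e)}"
  let ?V = "var_ideal E B :: ('a, 'l) mpoly set"
  have fB: "finite B" using assms finite_subset by auto
  have "?V [^]\<^bsub>ideals_set ?R\<^esub> Suc s = ideal_prod ?R (?P s) ?V"
    by (simp only: nat_pow_Suc Suc.IH) (simp add: ideals_set_def)
  also have "\<dots> = ?P (Suc s)"
  proof (intro equalityI subsetI)
    fix p assume "p \<in> ideal_prod ?R (?P s) ?V"
    then show "p \<in> ?P (Suc s)"
    proof (induction rule: ideal_prod.induct)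
      case (prod i j)
      have "Poly_Mapping.keys m \<subseteq> E \<and> Suc s \<le> (\<Sum>e \<in> B. Poly_Mapping.lookup m e)"
        if mk: "m \<in> Poly_Mapping.keys (i * j)" for m
      proof -
        obtain u v where uv: "m = u + v" "u \<in> Poly_Mapping.keys i" "v \<in> Poly_Mapping.keys j"
          using subsetD[OF Poly_Mapping.keys_mult mk] by blast
        obtain b where b: "b \<in> B" "b \<in> Poly_Mapping.keys v" and v: "Poly_Mapping.keys v \<subseteq> E"
          using prod(2) uv(3) unfolding var_ideal_eq[OF assms] by auto
        have u: "Poly_Mapping.keys u \<subseteq> E" "s \<le> (\<Sum>e \<in> B. Poly_Mapping.lookup u e)"
          using prod(1) uv(2) by auto
        have "1 \<le> Poly_Mapping.lookup v b" using b by (simp add: in_keys_iff)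
        also have "\<dots> \<le> (\<Sum>e \<in> B. Poly_Mapping.lookup v e)"
          using member_le_sum[of b B "Poly_Mapping.lookup v"] b fB by simp
        finally show ?thesis
          using u v unfolding uv(1) keys_plus_nat lookup_add sum.distrib by simp
      qed
      then show ?case by (simp add: poly_ring_def)
    next
      case (sum p q)
      then show ?case using Poly_Mapping.keys_add[of p q] by (auto simp: poly_ring_def)
    qed
  next
    fix p assume p: "p \<in> ?P (Suc s)"
    show "p \<in> ideal_prod ?R (?P s) ?V"
    proof (induction p rule: poly_mapping_single_add_induct)
      case zero
      \<comment> \<open>\<open>ideal_prod\<close> is generated inductively by products and sums
        alone, so zero has to enter as a product of zeros.\<close>
      have "0 \<otimes>\<^bsub>?R\<^esub> 0 \<in> ideal_prod ?R (?P s) ?V"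
        by (rule ideal_prod.prod) (simp_all add: var_ideal_eq[OF assms])
      then show ?case by (simp add: poly_ring_def)
    next
      case (single m)
      let ?c = "Poly_Mapping.lookup p m"
      have m: "Poly_Mapping.keys m \<subseteq> E" "Suc s \<le> (\<Sum>e \<in> B. Poly_Mapping.lookup m e)"
        using p single by auto
      have "\<exists>b \<in> B. Poly_Mapping.lookup m b \<noteq> 0"
        using m(2) by (metis not_less_eq_eq sum.neutral zero_le)
      then obtain b where b: "b \<in> B" "Poly_Mapping.lookup m b \<noteq> 0" by blast
      let ?b = "Poly_Mapping.single b (1::nat)"
      \<comment> \<open>Subtraction of exponents is truncated; it is exact here because
        \<open>b\<close> occurs in \<open>m\<close>.\<close>
      have eq: "m = (m - ?b) + ?b"
        by (rule poly_mapping_eqI) (use b in \<open>auto simp: lookup_add lookup_minus lookup_single when_def\<close>)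
      have "(\<Sum>e \<in> B. Poly_Mapping.lookup m e) = (\<Sum>e \<in> B. Poly_Mapping.lookup (m - ?b) e) + 1"
        by (subst eq) (use b fB in \<open>simp add: lookup_add lookup_single sum.distrib when_def\<close>)
      then have "s \<le> (\<Sum>e \<in> B. Poly_Mapping.lookup (m - ?b) e)" using m(2) by simp
      moreover have "Poly_Mapping.keys (m - ?b) \<subseteq> E"
        using m(1) by (auto simp: in_keys_iff lookup_minus)
      ultimately have "Poly_Mapping.single (m - ?b) ?c \<in> ?P s" by simp
      moreover have "Poly_Mapping.single ?b 1 \<in> ?V"
        using b assms by (auto simp: var_ideal_eq[OF assms])
      ultimately have
        "Poly_Mapping.single (m - ?b) ?c \<otimes>\<^bsub>?R\<^esub> Poly_Mapping.single ?b 1 \<in> ideal_prod ?R (?P s) ?V"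
        by (rule ideal_prod.prod)
      also have "Poly_Mapping.single (m - ?b) ?c \<otimes>\<^bsub>?R\<^esub> Poly_Mapping.single ?b 1 =
          Poly_Mapping.single m ?c"
        by (subst (2) eq) (simp add: poly_ring_def mult_single)
      finally show ?case .
    next
      case (add x y)
      then show ?case using ideal_prod.sum[of x ?R "?P s" ?V y] by (simp add: poly_ring_def)
    qed
  qed
  finally show ?case .
qed

section \<open>Membership in symbolic powers, and \<open>alpha\<close> as a minimum weight\<close>

context matroid
begin

lemma basis_subset_ground: "basis M B \<Longrightarrow> B \<subseteq> ground M"
  using indep_subset_ground by (auto simp: basis_def)

lemma mem_SR_symbolic_power_iff:
  "p \<in> (SR_symbolic_power M s :: ('a, 'l::field) mpoly set) \<longleftrightarrow>
    (\<forall>m \<in> Poly_Mapping.keys p. Poly_Mapping.keys m \<subseteq> ground M \<and>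
      (\<forall>B. basis M B \<longrightarrow> s \<le> (\<Sum>e \<in> ground M - B. Poly_Mapping.lookup m e)))"
proof -
  have "p \<in> (SR_symbolic_power M s :: ('a, 'l) mpoly set) \<longleftrightarrow>
      (\<forall>B. basis (dual M) B \<longrightarrow> (\<forall>m \<in> Poly_Mapping.keys p. Poly_Mapping.keys m \<subseteq> ground M \<and>
         s \<le> (\<Sum>e \<in> B. Poly_Mapping.lookup m e)))"
    by (auto simp: SR_symbolic_power_def basis_dual_iff var_ideal_power_eq[OF finite_ground])
  also have "\<dots> \<longleftrightarrow> (\<forall>B. basis M B \<longrightarrow> (\<forall>m \<in> Poly_Mapping.keys p.
      Poly_Mapping.keys m \<subseteq> ground M \<and> s \<le> (\<Sum>e \<in> ground M - B. Poly_Mapping.lookup m e)))"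
    (is "(\<forall>B. _ \<longrightarrow> ?Q B) \<longleftrightarrow> (\<forall>B. _ \<longrightarrow> ?Q (ground M - B))")
  proof (intro iffI allI impI)
    fix B assume R: "\<forall>B. basis (dual M) B \<longrightarrow> ?Q B" and B: "basis M B"
    have "basis (dual M) (ground M - B)"
      using B by (simp add: basis_dual_iff basis_subset_ground double_diff)
    with R show "?Q (ground M - B)" by blast
  next
    fix B assume R: "\<forall>B. basis M B \<longrightarrow> ?Q (ground M - B)" and "basis (dual M) B"
    then have "B \<subseteq> ground M" "basis M (ground M - B)" by (simp_all add: basis_dual_iff)
    with R have "?Q (ground M - (ground M - B))" by blast
    with \<open>B \<subseteq> ground M\<close> show "?Q B" by (simp only: double_diff order_refl)
  qed
  \<comment> \<open>Some basis exists, so the support condition survives being pulled out of the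
    quantifier over bases.\<close>
  finally show ?thesis using indep_extend_basis[OF indep_empty] by blast
qed

lemma monom_deg_eq:
  assumes "Poly_Mapping.keys m \<subseteq> ground M"
  shows "monom_deg m = (\<Sum>e \<in> ground M. Poly_Mapping.lookup m e)"
  unfolding monom_deg_def using assms finite_ground
  by (intro sum.mono_neutral_left) (auto simp: in_keys_iff)

text \<open>Membership is decided monomial by monomial, so a homogeneous member may be replaced by
  any one of its monomials. Thus \<open>alpha\<close> is the optimum of an integer covering problem:
  \<open>w\<close> is feasible with value \<open>d\<close>, and by \<open>min\<close> no feasible
  weight is lighter.\<close>

lemma alpha_SR_symbolic_power_eqI:
  assumes w: "\<And>B. basis M B \<Longrightarrow> s \<le> sum w (ground M - B)" "sum w (ground M) = d"
    and min: "\<And>v. (\<And>B. basis M B \<Longrightarrow> s \<le> sum v (ground M - B)) \<Longrightarrow> d \<le> sum v (ground M)"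
  shows "alpha (SR_symbolic_power M s :: ('a, 'l::field) mpoly set) = d"
  unfolding alpha_def
proof (rule Least_equality)
  \<comment> \<open>The values of \<open>w\<close> outside the ground set are arbitrary and are cut
    off here.\<close>
  define m where "m = (\<Sum>e \<in> ground M. Poly_Mapping.single e (w e))"
  have m: "Poly_Mapping.lookup m x = (if x \<in> ground M then w x else 0)" for x
    using finite_ground by (simp add: m_def lookup_sum lookup_single when_def)
  have keys: "Poly_Mapping.keys m \<subseteq> ground M" by (auto simp: in_keys_iff m split: if_splits)
  have deg: "monom_deg m = d" using w(2) by (simp add: monom_deg_eq[OF keys] m)
  have "(\<Sum>e \<in> ground M - B. Poly_Mapping.lookup m e) = sum w (ground M - B)" for B
    by (rule sum.cong) (auto simp: m)
  then have "Poly_Mapping.single m 1 \<in> (SR_symbolic_power M s :: ('a, 'l) mpoly set)"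
    unfolding mem_SR_symbolic_power_iff using keys w(1) by simp
  then show "\<exists>p \<in> (SR_symbolic_power M s :: ('a, 'l) mpoly set). p \<noteq> 0 \<and> homogeneous d p"
    using deg by (intro bexI[of _ "Poly_Mapping.single m 1"])
      (auto simp: homogeneous_def simp flip: keys_eq_empty)
next
  fix d' assume "\<exists>p \<in> (SR_symbolic_power M s :: ('a, 'l) mpoly set). p \<noteq> 0 \<and> homogeneous d' p"
  then obtain p :: "('a, 'l) mpoly"
    where p: "p \<in> SR_symbolic_power M s" "p \<noteq> 0" "homogeneous d' p" by blast
  then obtain m where m: "m \<in> Poly_Mapping.keys p" by (metis all_not_in_conv keys_eq_empty)
  with p(1) have keys: "Poly_Mapping.keys m \<subseteq> ground M"
    and "\<And>B. basis M B \<Longrightarrow> s \<le> (\<Sum>e \<in> ground M - B. Poly_Mapping.lookup m e)"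
    unfolding mem_SR_symbolic_power_iff by auto
  from min[OF this(2)] have "d \<le> monom_deg m" by (simp add: monom_deg_eq[OF keys])
  then show "d \<le> d'" using p(3) m by (simp add: homogeneous_def)
qed

end


section \<open>Ranks\<close>

context matroid
begin

lemma finite_indep_subsets: "U \<subseteq> ground M \<Longrightarrow> finite {X. X \<subseteq> U \<and> indep M X}"
  by (rule finite_subset[of _ "Pow U"]) (use finite_ground finite_subset in auto)

lemma indep_card_le_rk:
  assumes "U \<subseteq> ground M" "indep M X" "X \<subseteq> U"
  shows "card X \<le> rk M U"
  unfolding rk_def using finite_indep_subsets[OF assms(1)] assms(2,3) by (intro Max_ge) auto

lemma obtain_rk:
  assumes "U \<subseteq> ground M"
  obtains X where "X \<subseteq> U" "indep M X" "card X = rk M U"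
proof -
  have "rk M U \<in> card ` {X. X \<subseteq> U \<and> indep M X}"
    unfolding rk_def using finite_indep_subsets[OF assms] indep_empty by (intro Max_in) auto
  then show thesis using that by auto
qed

lemma rk_eq_card_iff:
  assumes "U \<subseteq> ground M"
  shows "rk M U = card U \<longleftrightarrow> indep M U"
proof
  assume "rk M U = card U"
  then obtain X where "X \<subseteq> U" "indep M X" "card X = card U" using obtain_rk[OF assms] by metis
  then show "indep M U" using card_subset_eq assms finite_ground finite_subset by metis
next
  assume U: "indep M U"
  obtain X where "X \<subseteq> U" "indep M X" "card X = rk M U" using obtain_rk[OF assms] .
  then show "rk M U = card U"
    using indep_card_le_rk[OF assms U] card_mono[of U X] indep_finite[OF U] by simp
qed

lemma basis_iff_card: "basis M B \<longleftrightarrow> indep M B \<and> card B = rk M (ground M)"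
proof
  assume B: "basis M B"
  obtain X where "indep M X" "card X = rk M (ground M)" using obtain_rk[of "ground M"] by auto
  then have "rk M (ground M) \<le> card B" using basis_card_le[OF B] by metis
  moreover have "card B \<le> rk M (ground M)"
    using B basis_subset_ground[OF B] by (intro indep_card_le_rk) (auto simp: basis_def)
  ultimately show "indep M B \<and> card B = rk M (ground M)" using B by (simp add: basis_def)
next
  assume "indep M B \<and> card B = rk M (ground M)"
  then show "basis M B" using indep_card_le_rk indep_subset_ground by (intro basisI_card) auto
qed

lemma rk_dual_ground: "rk (dual M) (ground M) = card (ground M) - rk M (ground M)"
proof -
  interpret D: matroid "dual M" by (rule matroid_dual)
  obtain B where B: "basis M B" using indep_extend_basis[OF indep_empty] by blast
  then have "B \<subseteq> ground M" by (rule basis_subset_ground)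
  then have "basis (dual M) (ground M - B)" using B by (simp add: basis_dual_iff double_diff)
  then have "card (ground M - B) = rk (dual M) (ground M)"
    by (simp add: D.basis_iff_card) (simp add: dual_def)
  then show ?thesis
    using B \<open>B \<subseteq> ground M\<close> finite_ground
    by (metis basis_iff_card card_Diff_subset finite_subset)
qed

text \<open>A dependent set contains a circuit, and a circuit of a paving matroid has at least as
  many elements as the rank.\<close>

lemma paving_indep:
  assumes "paving M" "X \<subseteq> ground M" "card X < rk M (ground M)"
  shows "indep M X"
proof (rule ccontr)
  assume "\<not> indep M X"
  then obtain C where C: "circuit M C" "C \<subseteq> X" using dependent_contains_circuit assms(2) by blast
  then have "card C \<le> card X" using assms(2) finite_ground by (meson card_mono finite_subset)
  then show False using assms(1,3) C(1) by (auto simp: paving_def)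
qed

end


section \<open>Sparse paving matroids\<close>

lemma obtain_maximal:
  fixes f :: "'b \<Rightarrow> 'c::linorder"
  assumes "finite S" "S \<noteq> {}"
  obtains x where "x \<in> S" "\<And>y. y \<in> S \<Longrightarrow> f y \<le> f x"
proof -
  have "Max (f ` S) \<in> f ` S" using assms by (intro Max_in) auto
  then obtain x where "x \<in> S" "Max (f ` S) = f x" by (rule imageE)
  then show thesis using assms(1) Max_ge[of "f ` S"] by (intro that[of x]) auto
qed

locale sparse_paving_matroid = matroid M for M :: "'a pre_matroid" +
  fixes n k :: nat
  assumes sparse: "sparse_paving M"
    and n_def: "n = card (ground M)"
    and k_def: "k = rk M (ground M)"
    and k_ge: "2 \<le> k"
    and k_le: "k + 2 \<le> n"
begin

lemma basis_iff: "basis M B \<longleftrightarrow> indep M B \<and> card B = k"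
  by (simp add: basis_iff_card k_def)

lemma indep_if_card_less:
  assumes "X \<subseteq> ground M" "card X < k"
  shows "indep M X"
  using sparse assms by (intro paving_indep) (simp_all add: sparse_paving_def k_def)

lemma rk_le:
  assumes "U \<subseteq> ground M"
  shows "rk M U \<le> k"
proof -
  obtain X where "X \<subseteq> U" "indep M X" "card X = rk M U" using obtain_rk[OF assms] .
  then show ?thesis using indep_card_le_rk[of "ground M" X] assms k_def by auto
qed

text \<open>This is \<open>paving_indep\<close> for the dual: the complement of \<open>U\<close> has
  fewer than \<open>n - k\<close> elements, so it is independent in the dual and avoids some
  basis.\<close>

lemma basis_within:
  assumes "U \<subseteq> ground M" "k < card U"
  obtains B where "basis M B" "B \<subseteq> U"
proof -
  interpret D: matroid "dual M" by (rule matroid_dual)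
  have fin: "finite U" using assms(1) finite_ground finite_subset by blast
  have "card (ground M - U) < rk (dual M) (ground (dual M))"
    using assms rk_dual_ground card_Diff_subset[OF fin assms(1)] k_le
    by (simp add: n_def k_def dual_def)
  then have "indep (dual M) (ground M - U)"
    using sparse by (intro D.paving_indep) (auto simp: sparse_paving_def dual_def)
  then obtain B where "basis M B" "B \<inter> (ground M - U) = {}" by (auto simp: dual_def)
  then show thesis using that basis_subset_ground by blast
qed

text \<open>Two circuit-hyperplanes never differ by a single exchange.\<close>

lemma exchange_basis:
  assumes T: "T \<subseteq> ground M" "card T = k" "\<not> basis M T" and a: "a \<in> T" and b: "b \<in> ground M - T"
  shows "basis M (insert b (T - {a}))"
proof -
  have fin: "finite T" using T(1) finite_ground finite_subset by blast
  have "k < card (insert b T)" using fin b T(2) by simp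
  moreover have "insert b T \<subseteq> ground M" using b T(1) by auto
  ultimately obtain B where B: "basis M B" "B \<subseteq> insert b T" using basis_within by blast
  have card: "card (T - {a}) = k - 1" using fin a T(2) by simp
  then have "indep M (T - {a})" using T(1) k_ge by (intro indep_if_card_less) auto
  \<comment> \<open>Since \<open>B\<close> lies in \<open>insert b T\<close>, only \<open>a\<close>
    and \<open>b\<close> can be added, and adding \<open>a\<close> would make \<open>T\<close>
    itself a basis.\<close>
  then obtain y where y: "y \<in> B - (T - {a})" "indep M (insert y (T - {a}))"
    using augmentation[of "T - {a}" B] B(1) card k_ge by (auto simp: basis_iff)
  have "y \<noteq> a" using y(2) T a by (auto simp: basis_iff insert_absorb)
  then have "y = b" using y(1) B(2) by auto
  then show ?thesis using y(2) card fin b k_ge by (simp add: basis_iff)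
qed

section \<open>Generalized Hamming weights\<close>

lemma nullity_eq_cases:
  assumes U: "U \<subseteq> ground M" "card U = rk M U + r" and r: "1 \<le> r"
  shows "card U = k + r \<or> (card U = k \<and> r = 1 \<and> \<not> uniform M)"
proof -
  have fin: "finite U" using U(1) finite_ground finite_subset by blast
  \<comment> \<open>Positive nullity means dependence, which is impossible below size
    \<open>k\<close>. At size \<open>k\<close>, deleting one element leaves an independent set, so
    the nullity is exactly 1. Above size \<open>k\<close> the rank is \<open>k\<close>.\<close>
  have dep: "\<not> indep M U" using rk_eq_card_iff[OF U(1)] U(2) r by simp
  consider "card U < k" | "card U = k" | "k < card U" by linarith
  then show ?thesis
  proof cases
    case 1
    then show ?thesis using dep indep_if_card_less[OF U(1)] by simp
  next
    case 2
    then obtain a where a: "a \<in> U" using k_ge by fastforce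
    have card: "card (U - {a}) = k - 1" using 2 a fin by simp
    then have "indep M (U - {a})" using U(1) k_ge by (intro indep_if_card_less) auto
    then have "k - 1 \<le> rk M U" using indep_card_le_rk[OF U(1), of "U - {a}"] card by auto
    moreover have "\<not> uniform M" using dep 2 U(1) k_def by (auto simp: uniform_def basis_def)
    ultimately show ?thesis using 2 U(2) r k_ge by linarith
  next
    case 3
    obtain B where B: "basis M B" "B \<subseteq> U" using basis_within[OF U(1) 3] .
    then have "k \<le> rk M U" using indep_card_le_rk[OF U(1), of B] by (auto simp: basis_iff)
    then show ?thesis using rk_le[OF U(1)] U(2) by simp
  qed
qed

lemma rk_large:
  assumes "U \<subseteq> ground M" "k < card U"
  shows "rk M U = k"
proof -
  obtain B where B: "basis M B" "B \<subseteq> U" using basis_within[OF assms] .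
  then have "k \<le> rk M U" using indep_card_le_rk[OF assms(1), of B] by (auto simp: basis_iff)
  then show ?thesis using rk_le[OF assms(1)] by simp
qed

text \<open>The closed form of the weights for \<open>r\<close> in \<open>{1..n - k}\<close>; the
  exception comes from dependent \<open>k\<close>-sets, which have nullity 1.\<close>

abbreviation hamming :: "nat \<Rightarrow> nat" where
  "hamming r \<equiv> (if r = 1 \<and> \<not> uniform M then k else k + r)"

text \<open>The witness is a dependent \<open>k\<close>-set in the exceptional case and otherwise
  any set of size \<open>k + r\<close>, which has full rank; \<open>r \<le> n - k\<close> leaves
  room for it.\<close>

lemma obtain_nullity:
  assumes r: "r \<in> {1..n - k}"
  obtains U where "U \<subseteq> ground M" "card U = rk M U + r" "card U = hamming r"
proof (cases "r = 1 \<and> \<not> uniform M")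
  case True
  then obtain U where U: "U \<subseteq> ground M" "card U = k" "\<not> basis M U"
    using k_def by (auto simp: uniform_def)
  then have fin: "finite U" using finite_ground finite_subset by blast
  have "rk M U \<noteq> k" using rk_eq_card_iff[OF U(1)] U by (auto simp: basis_iff)
  moreover have "rk M U \<le> k" by (rule rk_le[OF U(1)])
  moreover obtain a where a: "a \<in> U" using U(2) k_ge by fastforce
  have card: "card (U - {a}) = k - 1" using U(2) a fin by simp
  then have "indep M (U - {a})" using U(1) k_ge by (intro indep_if_card_less) auto
  then have "k - 1 \<le> rk M U" using indep_card_le_rk[OF U(1), of "U - {a}"] card by auto
  ultimately show thesis using True U k_ge by (intro that[of U]) auto
next
  case False
  have "k + r \<le> card (ground M)" using r k_le n_def by auto
  then obtain U where U: "U \<subseteq> ground M" "card U = k + r"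
    by (meson obtain_subset_with_card_n)
  then show thesis using False r rk_large[OF U(1)] by (intro that[of U]) auto
qed

lemma gen_hamming_weight_eq:
  assumes r: "r \<in> {1..n - k}"
  shows "gen_hamming_weight M r = hamming r"
  unfolding gen_hamming_weight_def
proof (rule Min_eqI)
  show "finite {card U | U. U \<subseteq> ground M \<and> card U = rk M U + r}"
  proof (rule finite_subset)
    show "{card U | U. U \<subseteq> ground M \<and> card U = rk M U + r} \<subseteq> card ` Pow (ground M)" by blast
    show "finite (card ` Pow (ground M))" using finite_ground by simp
  qed
  show "hamming r \<le> y" if y: "y \<in> {card U | U. U \<subseteq> ground M \<and> card U = rk M U + r}" for y
  proof -
    obtain U where U: "U \<subseteq> ground M" "card U = rk M U + r" "y = card U" using y by blast
    from nullity_eq_cases[OF U(1,2)] r show ?thesis unfolding U(3) by auto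
  qed
  show "hamming r \<in> {card U | U. U \<subseteq> ground M \<and> card U = rk M U + r}"
  proof -
    obtain U where U: "U \<subseteq> ground M" "card U = rk M U + r" "card U = hamming r"
      using obtain_nullity[OF r] .
    show ?thesis by (rule CollectI, rule exI[of _ U], intro conjI U(3)[symmetric] U(1,2))
  qed
qed

section \<open>Subadditivity of the weights and of their Wei dual\<close>

lemma subadditive_gen_hamming_weight: "subadditive (n - k) (gen_hamming_weight M)"
  unfolding subadditive_def
proof (intro allI impI)
  fix i j assume "i \<in> {1..n - k} \<and> j \<in> {1..n - k} \<and> i + j \<in> {1..n - k}"
  \<comment> \<open>As \<open>i + j\<close> is at least 2, the exception can occur only on the
    right. It costs at most 1 per summand, and \<open>2 \<le> k\<close> absorbs both losses.\<close>
  then show "gen_hamming_weight M (i + j) \<le> gen_hamming_weight M i + gen_hamming_weight M j"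
    using k_ge by (simp add: gen_hamming_weight_eq)
qed

text \<open>The weights with index at least 2 remove exactly \<open>{1..n - k - 1}\<close>. The
  first weight removes one of \<open>n - k\<close> and \<open>n - k + 1\<close>, and the other one
  heads the list.\<close>

lemma wei_dual_eq:
  "wei_dual n (n - k) (gen_hamming_weight M) =
    (if uniform M then n - k + 1 else n - k) # [n - k + 2..<n + 1]"
    (is "_ = ?e # ?xs")
proof -
  have "{n + 1 - gen_hamming_weight M j | j. j \<in> {1..n - k}} =
      (\<lambda>j. n + 1 - hamming j) ` {1..n - k}"
    by (simp only: setcompr_eq_image Collect_mem_eq gen_hamming_weight_eq cong: image_cong)
  also have "\<dots> = (\<lambda>j. n + 1 - hamming j) ` insert 1 {2..n - k}"
    using k_le by (intro arg_cong[where f = "image _"]) auto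
  also have "\<dots> = insert (n + 1 - hamming 1) ((\<lambda>j. n + 1 - (k + j)) ` {2..n - k})"
    by (simp add: image_iff)
  also have "(\<lambda>j. n + 1 - (k + j)) ` {2..n - k} = {1..n - k - 1}"
  proof (intro equalityI subsetI)
    fix x assume "x \<in> {1..n - k - 1}"
    then show "x \<in> (\<lambda>j. n + 1 - (k + j)) ` {2..n - k}"
      by (intro image_eqI[of _ _ "n + 1 - k - x"]) auto
  qed auto
  finally have "{1..n} - {n + 1 - gen_hamming_weight M j | j. j \<in> {1..n - k}} =
      {1..n} - insert (n + 1 - hamming 1) {1..n - k - 1}" by simp
  also have "\<dots> = set (?e # ?xs)"
  proof -
    obtain N where "n = k + 2 + N" using le_Suc_ex[OF k_le] by blast
    then show ?thesis using k_ge by (auto simp: set_upt simp del: upt_Suc)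
  qed
  finally have "wei_dual n (n - k) (gen_hamming_weight M) = sorted_list_of_set (set (?e # ?xs))"
    by (simp only: wei_dual_def)
  also have "\<dots> = ?e # ?xs"
    by (rule sorted_list_of_set.idem_if_sorted_distinct) (auto simp del: upt_Suc)
  finally show ?thesis .
qed

lemma cosubadditive_gen_hamming_weight: "cosubadditive n (n - k) (gen_hamming_weight M)"
  unfolding cosubadditive_def subadditive_def wei_dual_eq
proof (intro allI impI)
  let ?l = "(if uniform M then n - k + 1 else n - k) # [n - k + 2..<n + 1]"
  fix i j assume ij: "i \<in> {1..length ?l} \<and> j \<in> {1..length ?l} \<and> i + j \<in> {1..length ?l}"
  have len: "length ?l = k" using k_ge k_le by simp presburger
  have ij': "1 \<le> i" "1 \<le> j" "i + j \<le> k" using ij unfolding len by auto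
  have nth: "?l ! (i - 1) = n - k + i" if "2 \<le> i" "i \<le> k" for i
    using that k_le by (cases "i - 1") (auto simp del: upt_Suc)
  \<comment> \<open>Only the head of the list can fall short of \<open>n - k + i\<close>, and by at
    most 1. Two such losses are absorbed by \<open>n - k \<ge> 2\<close>.\<close>
  have ge: "n - k + i \<le> Suc (?l ! (i - 1))" if "1 \<le> i" "i \<le> k" for i
  proof (cases "i = 1")
    case False
    then show ?thesis using nth[of i] that by linarith
  qed auto
  have "?l ! (i + j - 1) = n - k + (i + j)" using ij' by (intro nth) auto
  moreover have "n - k + i \<le> Suc (?l ! (i - 1))" "n - k + j \<le> Suc (?l ! (j - 1))"
    using ij' by (intro ge; linarith)+
  ultimately show "?l ! (i + j - 1) \<le> ?l ! (i - 1) + ?l ! (j - 1)" using k_le by linarith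
qed

section \<open>The lower bound on feasible weights\<close>

lemma obtain_heaviest:
  fixes w :: "'a \<Rightarrow> nat"
  obtains T where "T \<subseteq> ground M" "card T = k"
    "\<And>a b. a \<in> T \<Longrightarrow> b \<in> ground M - T \<Longrightarrow> w b \<le> w a"
proof -
  let ?F = "{T. T \<subseteq> ground M \<and> card T = k}"
  obtain T0 where "T0 \<in> ?F" using obtain_subset_with_card_n[of k "ground M"] n_def k_le by auto
  then have ne: "?F \<noteq> {}" by blast
  have "finite ?F" using finite_ground by simp
  then obtain T where T: "T \<in> ?F" "\<And>T'. T' \<in> ?F \<Longrightarrow> sum w T' \<le> sum w T"
    using obtain_maximal[OF _ ne, of "sum w"] by blast
  have fin: "finite T" using T(1) finite_ground finite_subset by auto
  \<comment> \<open>Otherwise exchanging \<open>a\<close> for \<open>b\<close> would give a heavier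
    \<open>k\<close>-set.\<close>
  have "w b \<le> w a" if a: "a \<in> T" and b: "b \<in> ground M - T" for a b
  proof -
    have "insert b (T - {a}) \<in> ?F" using T(1) a b fin k_ge by auto
    from T(2)[OF this] have "w b + sum w (T - {a}) \<le> sum w T" using b fin by simp
    then show ?thesis using sum.remove[OF fin a, of w] by simp
  qed
  then show thesis using T(1) by (intro that[of T]) auto
qed

lemma weight_lower_bound:
  fixes w :: "'a \<Rightarrow> nat"
  assumes w: "\<And>B. basis M B \<Longrightarrow> (n - k) * q + r \<le> sum w (ground M - B)" and r: "1 \<le> r"
  shows "n * q + hamming r \<le> sum w (ground M)"
proof -
  obtain T where T: "T \<subseteq> ground M" "card T = k"
    and le: "\<And>a b. a \<in> T \<Longrightarrow> b \<in> ground M - T \<Longrightarrow> w b \<le> w a"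
    by (rule obtain_heaviest[of w]) auto
  let ?L = "ground M - T"
  have finT: "finite T" using T(1) finite_ground finite_subset by blast
  have finL: "finite ?L" using finite_ground by blast
  have cardL: "card ?L = n - k" using T finT by (simp add: card_Diff_subset n_def)
  have ne: "?L \<noteq> {}" "T \<noteq> {}"
    unfolding card_0_eq[OF finL, symmetric] card_0_eq[OF finT, symmetric] cardL T(2)
    using k_ge k_le by auto
  have total: "sum w (ground M) = sum w ?L + sum w T"
    using sum.subset_diff[OF T(1) finite_ground] .
  \<comment> \<open>The first summand is the share of the complement of a basis, the second that of
    the basis itself.\<close>
  have split: "n * q = (n - k) * q + k * q" using k_le by (simp flip: add_mult_distrib)
  obtain b where b: "b \<in> ?L" "\<And>x. x \<in> ?L \<Longrightarrow> w x \<le> w b"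
    using obtain_maximal[OF finL ne(1), of w] by blast
  obtain a where a: "a \<in> T" "\<And>x. x \<in> T \<Longrightarrow> w a \<le> w x"
    using that[OF arg_min_if_finite(1)[OF finT ne(2)] arg_min_least[OF finT ne(2)]] .
  have T_a: "sum w T = w a + sum w (T - {a})" using sum.remove[OF finT a(1)] .
  have L_b: "sum w ?L = w b + sum w (?L - {b})" using sum.remove[OF finL b(1)] .
  have T_rest: "(k - 1) * w a \<le> sum w (T - {a})"
    using sum_bounded_below[of "T - {a}" "w a" w] a finT T(2) by simp
  have L_rest: "sum w (?L - {b}) \<le> (n - k - 1) * w b"
    using sum_bounded_above[of "?L - {b}" w "w b"] b finL cardL by simp
  show ?thesis
  proof (cases "basis M T")
    case True
    then have s: "(n - k) * q + r \<le> sum w ?L" by (rule w)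
    have "sum w ?L \<le> (n - k) * w b"
      using sum_bounded_above[of ?L w "w b"] b cardL by simp
    \<comment> \<open>Since \<open>r\<close> is positive, the average weight outside
      \<open>T\<close> exceeds \<open>q\<close>, hence so does the maximum
      \<open>w b\<close>.\<close>
    then have "(n - k) * q < (n - k) * w b" using s r by linarith
    then have "q + 1 \<le> w a" using le[OF a(1) b(1)] by simp
    then have "k * (q + 1) \<le> k * w a" by (rule mult_le_mono2)
    also have "\<dots> \<le> sum w T" using sum_bounded_below[of T "w a" w] a T(2) by simp
    finally have "k * q + k \<le> sum w T" by simp
    then show ?thesis using s total split by (simp add: r)
  next
    case False
    \<comment> \<open>This lowers the target at \<open>r = 1\<close> to
      \<open>hamming 1 = k\<close>.\<close>
    then have nu: "\<not> uniform M" using T k_def by (auto simp: uniform_def)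
    have "basis M (insert b (T - {a}))" by (rule exchange_basis[OF T False a(1) b(1)])
    then have "(n - k) * q + r \<le> sum w (ground M - insert b (T - {a}))" by (rule w)
    also have "ground M - insert b (T - {a}) = insert a (?L - {b})"
      using a(1) b(1) T(1) by auto
    also have "sum w \<dots> = w a + sum w (?L - {b})" using a(1) finL by simp
    finally have s: "(n - k) * q + r \<le> w a + sum w (?L - {b})" .
    obtain N where "n = k + 2 + N" using le_Suc_ex[OF k_le] by blast
    then have N: "n - k = Suc (Suc N)" by simp
    obtain k' where k': "k = 2 + k'" using le_Suc_ex[OF k_ge] by blast
    \<comment> \<open>The constraint \<open>s\<close> covers the complement of the exchanged basis;
      what remains is the weight of that basis. The term \<open>r\<close> stands on the right to
      avoid a subtraction.\<close>
    have goal: "k * q + hamming r \<le> w b + sum w (T - {a}) + r"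
    proof (cases "q + 1 \<le> w b")
      case True
      \<comment> \<open>Every element of the exchanged basis now weighs at least
        \<open>q + 1\<close>.\<close>
      then have "(k - 1) * (q + 1) \<le> (k - 1) * w a"
        using le[OF a(1) b(1)] by (intro mult_le_mono2) simp
      then have "(k - 1) * (q + 1) + (q + 1) \<le> w b + sum w (T - {a})"
        using True T_rest by linarith
      then have "k * (q + 1) \<le> w b + sum w (T - {a})" by (simp add: k')
      then show ?thesis by (simp add: r)
    next
      case False
      then have "w b \<le> q" by simp
      then obtain t where t: "q = w b + t" using le_Suc_ex by blast
      \<comment> \<open>The \<open>Suc N\<close> elements outside \<open>T\<close> other than
        \<open>b\<close> weigh at most \<open>q - t\<close> each, so \<open>a\<close> alone has to
        make up for the deficit. One of the \<open>Suc N\<close> copies of \<open>t\<close> is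
        enough below.\<close>
      have "Suc N * w b + q + Suc N * t + r \<le> w a + Suc N * w b"
        using s L_rest unfolding N by (simp add: t algebra_simps)
      then have wa: "q + t + r \<le> w a" by simp
      have "(k - 1) * (q + t + r) \<le> (k - 1) * w a" using wa by (rule mult_le_mono2)
      then have "(k - 1) * (q + t + r) \<le> sum w (T - {a})" using T_rest by linarith
      \<comment> \<open>With \<open>w b = q - t\<close>, the right side exceeds \<open>k * q\<close>
        by \<open>k' * t + (k' + 1) * r + r\<close>. This is at least \<open>k\<close> for
        \<open>r = 1\<close> and at least \<open>k + r\<close> for \<open>r \<ge> 2\<close>.\<close>
      moreover have "k * q + hamming r \<le> w b + (k - 1) * (q + t + r) + r"
      proof (cases "r = 1")
        case False
        then have "2 + k' * 1 \<le> r + k' * (r + t)" using r by (intro add_mono mult_le_mono2) auto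
        then show ?thesis using False by (simp add: k' t algebra_simps)
      qed (use nu in \<open>simp add: k' t algebra_simps\<close>)
      ultimately show ?thesis by linarith
    qed
    then show ?thesis using s total split T_a L_b by linarith
  qed
qed

lemma alpha_eq:
  assumes r: "r \<in> {1..n - k}"
  shows "alpha (SR_symbolic_power M ((n - k) * q + r) :: ('a, 'l::field) mpoly set) =
    n * q + hamming r"
proof -
  obtain U where U: "U \<subseteq> ground M" "card U = rk M U + r" "card U = hamming r"
    using obtain_nullity[OF r] .
  let ?w = "\<lambda>x. q + (if x \<in> U then 1 else 0)"
  have fin: "finite U" using U(1) finite_ground finite_subset by blast
  have sum_w: "sum ?w A = card A * q + card (A \<inter> U)" if "A \<subseteq> ground M" for A
    using that finite_ground finite_subset[of A] by (simp add: sum.distrib sum.If_cases)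
  show ?thesis
  proof (rule alpha_SR_symbolic_power_eqI[where w = ?w])
    fix B assume B: "basis M B"
    have sub: "B \<subseteq> ground M" using basis_subset_ground[OF B] .
    have "card (ground M - B) = n - k"
      using B sub finite_ground by (simp add: basis_iff n_def card_Diff_subset finite_subset)
    \<comment> \<open>Hence at least \<open>card U - rk M U = r\<close> elements of \<open>U\<close>
      lie outside \<open>B\<close>.\<close>
    moreover have "card (B \<inter> U) \<le> rk M U"
      using B indep_subset by (intro indep_card_le_rk[OF U(1)]) (auto simp: basis_def)
    moreover have "(ground M - B) \<inter> U = U - B \<inter> U" using U(1) by blast
    then have "card ((ground M - B) \<inter> U) = card U - card (B \<inter> U)"
      using fin by (simp add: card_Diff_subset)
    ultimately show "(n - k) * q + r \<le> sum ?w (ground M - B)"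
      using U(2) by (simp add: sum_w)
  next
    show "sum ?w (ground M) = n * q + hamming r"
      using U by (simp only: sum_w[OF order_refl] n_def Int_absorb1)
  next
    show "n * q + hamming r \<le> sum v (ground M)"
      if "\<And>B. basis M B \<Longrightarrow> (n - k) * q + r \<le> sum v (ground M - B)" for v
      using weight_lower_bound[OF that] r by simp
  qed
qed

section \<open>The asymptotic ratio\<close>

lemma alpha_ratio_tendsto:
  "(\<lambda>s. real (alpha (SR_symbolic_power M s :: ('a, 'l::field) mpoly set)) / real s)
     \<longlonglongrightarrow> real n / real (n - k)"
proof -
  let ?a = "\<lambda>s. real (alpha (SR_symbolic_power M s :: ('a, 'l) mpoly set)) / real s"
  let ?N = "n - k"
  \<comment> \<open>The difference between \<open>alpha\<close> and \<open>n * s / (n - k)\<close>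
    depends only on \<open>r\<close> and is at most \<open>n\<close> in absolute value.\<close>
  have bound: "\<bar>?a s - real n / real ?N\<bar> \<le> real n / real s" if s: "1 \<le> s" for s
  proof -
    \<comment> \<open>The shift by one makes the remainder run through \<open>{1..?N}\<close>
      instead of \<open>{0..?N - 1}\<close>.\<close>
    define q r where "q = (s - 1) div ?N" and "r = (s - 1) mod ?N + 1"
    have r: "r \<in> {1..?N}" using k_le by (simp add: r_def Suc_le_eq)
    have qr: "s = ?N * q + r" using s by (simp add: q_def r_def)
    have a: "alpha (SR_symbolic_power M s :: ('a, 'l) mpoly set) = n * q + hamming r"
      unfolding qr by (rule alpha_eq[OF r])
    have N: "0 < real ?N" using k_le by simp
    have "?a s - real n / real ?N =
        (real (n * q + hamming r) * ?N - real n * s) / (real s * ?N)"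
      unfolding a using N s by (intro diff_frac_eq) auto
    also have "real (n * q + hamming r) * ?N - real n * s = ?N * hamming r - real n * r"
      by (simp only: qr of_nat_add of_nat_mult) (simp only: algebra_simps)
    finally have "?a s - real n / real ?N = (?N * hamming r - real n * r) / (real s * ?N)" .
    \<comment> \<open>Both terms lie between 0 and \<open>n * ?N\<close>, hence so does the absolute
      value of their difference.\<close>
    moreover have "\<bar>?N * hamming r - real n * r\<bar> \<le> real n * ?N"
    proof -
      have "hamming r \<le> n" using r k_le by auto
      then have "real ?N * hamming r \<le> ?N * real n" by (intro mult_left_mono) auto
      moreover have "real n * r \<le> real n * ?N" using r by (intro mult_left_mono) auto
      moreover have "0 \<le> real ?N * hamming r" "0 \<le> real n * r" by auto
      ultimately show ?thesis unfolding abs_le_iff of_nat_mult by (simp only: mult.commute) linarith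
    qed
    ultimately have "\<bar>?a s - real n / real ?N\<bar> \<le> real n * ?N / (real s * ?N)"
      by (simp only: abs_divide) (intro frac_le; use N s in simp)
    then show ?thesis using N by simp
  qed
  have "(\<lambda>s. ?a s - real n / real ?N) \<longlonglongrightarrow> 0"
  proof (rule tendsto_0_le)
    show "\<forall>\<^sub>F s in sequentially. norm (?a s - real n / real ?N) \<le> norm (real n / real s) * 1"
      using eventually_ge_at_top[of 1] by eventually_elim (use bound in auto)
    show "(\<lambda>s. real n / real s) \<longlonglongrightarrow> 0" by (rule lim_const_over_n)
  qed
  then show ?thesis by (simp add: LIM_zero_iff)
qed

end

theorem corollary6p4:
  fixes M :: "'a pre_matroid" and n k :: nat
  assumes "matroid M"
    and "sparse_paving M"
    and "n = card (ground M)"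
    and "k = rk M (ground M)"
    and "2 \<le> k" and "k + 2 \<le> n"
    and "\<forall>e. \<not> loop M e"
    and "\<forall>e. \<not> coloop M e"
  shows "subadditive (n - k) (gen_hamming_weight M) \<and>
    cosubadditive n (n - k) (gen_hamming_weight M) \<and>
    (\<forall>s q r. r \<in> {1..n - k} \<and> s = (n - k) * q + r \<longrightarrow>
      alpha (SR_symbolic_power M s :: ('a, 'l::field) mpoly set) = n * q + gen_hamming_weight M r \<and>
      n * q + gen_hamming_weight M r =
        (if r = 1 \<and> \<not> uniform M then n * q + k else n * q + (k + r))) \<and>
    convergent (\<lambda>s. real (alpha (SR_symbolic_power M s :: ('a, 'l) mpoly set)) / real s) \<and>
    waldschmidt (SR_symbolic_power M :: nat \<Rightarrow> ('a, 'l) mpoly set) = real n / real (n - k)"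
proof -
  interpret sparse_paving_matroid M n k
    using assms by (simp add: sparse_paving_matroid_def sparse_paving_matroid_axioms_def)
  show ?thesis
  proof (intro conjI allI impI)
    show "subadditive (n - k) (gen_hamming_weight M)"
      by (rule subadditive_gen_hamming_weight)
    show "cosubadditive n (n - k) (gen_hamming_weight M)"
      by (rule cosubadditive_gen_hamming_weight)
    show "alpha (SR_symbolic_power M s :: ('a, 'l) mpoly set) = n * q + gen_hamming_weight M r"
      if "r \<in> {1..n - k} \<and> s = (n - k) * q + r" for s q r
      using that alpha_eq[of r q, where 'l = 'l] by (simp only: gen_hamming_weight_eq)
    show "n * q + gen_hamming_weight M r =
        (if r = 1 \<and> \<not> uniform M then n * q + k else n * q + (k + r))"
      if "r \<in> {1..n - k} \<and> s = (n - k) * q + r" for s q r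
      using that by (simp add: gen_hamming_weight_eq)
    show "convergent (\<lambda>s. real (alpha (SR_symbolic_power M s :: ('a, 'l) mpoly set)) / real s)"
      using alpha_ratio_tendsto by (rule convergentI)
    show "waldschmidt (SR_symbolic_power M :: nat \<Rightarrow> ('a, 'l) mpoly set) = real n / real (n - k)"
      unfolding waldschmidt_def using alpha_ratio_tendsto by (rule limI)
  qed
qed

end
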